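(* Let $\mathbb{T}=\{z\in\mathbb{C}:|z|=1\}$ and let $R=C^1(\mathbb{T})$ be the commutative unital complex semisimple Banach algebra of continuously differentiable functions $\mathbb{T}\to\mathbb{C}$, with the involution $f^\star(z)=\overline{f(\overline{z})}$ $(z\in\mathbb{T})$. Let $A,B,C\in R$ (regarded as $1\times 1$ matrices over $R$) be given by $A(z)=z$, $B(z)=1$, $C(z)=1$ for $z\in\mathbb{T}$. Then for every $\varphi\in M(R)$ the pairs $(\widehat{A}(\varphi),\widehat{B}(\varphi))$ and $(\widehat{A^\star}(\varphi),\widehat{C^\star}(\varphi))$ are controllable, but there is no $P\in R$ such that $$PBB^\star P-PA-A^\star P-C^\star C=0.$$
   Context: $C^1(\mathbb{T})$ has pointwise operations and the norm $\|f\|=\|f\|_\infty+\|f'\|_\infty$, where $f'(e^{i\theta})=\frac{dF}{d\theta}(\theta)$ with $F(\theta)=f(e^{i\theta})$, $\theta\in\mathbb{R}$. $M(R)$ is the maximal ideal space of $R$, i.e. the set of complex homomorphisms (nonzero multiplicative linear functionals) $\varphi:R\to\mathbb{C}$, and the Gelfand transform of $x\in R$ is $\widehat{x}(\varphi)=\varphi(x)$. For matrices $A_0\in\mathbb{C}^{n\times n}$, $B_0\in\mathbb{C}^{n\times m}$, the pair $(A_0,B_0)$ is controllable if $\operatorname{rank}[B_0\ \ A_0B_0\ \ \cdots\ \ A_0^{n-1}B_0]=n$ (here $n=m=1$). *)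

theory Defs
  imports "HOL-Analysis.Analysis" "Jordan_Normal_Form.DL_Rank"
begin

section \<open>The unit circle\<close>

typedef circle = "sphere (0::complex) 1"
  morphisms of_circle Abs_circle
  by (rule exI[of _ 1]) simp

setup_lifting type_definition_circle

lift_definition circle_cis :: "real \<Rightarrow> circle" is cis
  by simp

lift_definition circle_cnj :: "circle \<Rightarrow> circle" is cnj
  by simp

lemma of_circle_cis [simp]: "of_circle (circle_cis t) = cis t"
  by (rule circle_cis.rep_eq)

lemma of_circle_cnj [simp]: "of_circle (circle_cnj z) = cnj (of_circle z)"
  by (rule circle_cnj.rep_eq)

lemma norm_of_circle [simp]: "norm (of_circle z) = 1"
  using of_circle[of z] by simp

lemma circle_cis_Arg [simp]: "circle_cis (Arg (of_circle z)) = z"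
proof -
  have "of_circle z \<noteq> 0"
    using norm_of_circle[of z] by force
  then have "cis (Arg (of_circle z)) = of_circle z"
    by (simp add: cis_Arg sgn_div_norm)
  then show ?thesis
    by (simp flip: of_circle_inject)
qed

lemma circle_cis_cnj: "circle_cnj (circle_cis t) = circle_cis (- t)"
  by (simp flip: of_circle_inject add: cis_cnj)


section \<open>The algebra of continuously differentiable functions on the circle\<close>

typedef c1_circle =
    "{f :: circle \<Rightarrow> complex. (\<lambda>\<theta>. f (circle_cis \<theta>)) C1_differentiable_on UNIV}"
  morphisms c1_apply Abs_c1_circle
  by (rule exI[of _ "\<lambda>_. 0"]) simp

setup_lifting type_definition_c1_circle

lemma c1_eqI: "(\<And>z. c1_apply f z = c1_apply g z) \<Longrightarrow> f = g"
  by (simp flip: c1_apply_inject add: fun_eq_iff)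

instantiation c1_circle :: comm_ring_1
begin
lift_definition zero_c1_circle :: c1_circle is "\<lambda>z. 0" by simp
lift_definition one_c1_circle :: c1_circle is "\<lambda>z. 1" by simp
lift_definition plus_c1_circle :: "c1_circle \<Rightarrow> c1_circle \<Rightarrow> c1_circle"
  is "\<lambda>f g z. f z + g z" by simp
lift_definition uminus_c1_circle :: "c1_circle \<Rightarrow> c1_circle"
  is "\<lambda>f z. - f z" by simp
lift_definition minus_c1_circle :: "c1_circle \<Rightarrow> c1_circle \<Rightarrow> c1_circle"
  is "\<lambda>f g z. f z - g z" by simp
lift_definition times_c1_circle :: "c1_circle \<Rightarrow> c1_circle \<Rightarrow> c1_circle"
  is "\<lambda>f g z. f z * g z" by simp
instance
  by standard (transfer; simp add: fun_eq_iff algebra_simps)+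
end

lift_definition c1_scaleC :: "complex \<Rightarrow> c1_circle \<Rightarrow> c1_circle"
  is "\<lambda>c f z. c * f z" by simp

lemma c1_apply_simps [simp]:
  "c1_apply 0 z = 0" "c1_apply 1 z = 1"
  "c1_apply (f + g) z = c1_apply f z + c1_apply g z"
  "c1_apply (- f) z = - c1_apply f z"
  "c1_apply (f - g) z = c1_apply f z - c1_apply g z"
  "c1_apply (f * g) z = c1_apply f z * c1_apply g z"
  "c1_apply (c1_scaleC c f) z = c * c1_apply f z"
  by (transfer; simp)+

interpretation c1_circle: vector_space c1_scaleC
  by unfold_locales (auto intro!: c1_eqI simp: algebra_simps)

lift_definition c1_star :: "c1_circle \<Rightarrow> c1_circle"
  is "\<lambda>f z. cnj (f (circle_cnj z))"
proof -
  fix f :: "circle \<Rightarrow> complex"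
  assume "(\<lambda>\<theta>. f (circle_cis \<theta>)) C1_differentiable_on UNIV"
  then obtain D where D: "\<And>t. ((\<lambda>\<theta>. f (circle_cis \<theta>)) has_vector_derivative D t) (at t)"
      and cont: "continuous_on UNIV D"
    by (auto simp: C1_differentiable_on_def)
  have "((\<lambda>\<theta>. cnj (f (circle_cnj (circle_cis \<theta>)))) has_vector_derivative - cnj (D (- t))) (at t)" for t
  proof -
    have "(((\<lambda>\<theta>. f (circle_cis \<theta>)) \<circ> uminus) has_vector_derivative (- 1) *\<^sub>R D (- t)) (at t)"
      by (rule vector_diff_chain_at) (auto intro!: derivative_eq_intros D)
    then have "((\<lambda>\<theta>. cnj (f (circle_cis (- \<theta>)))) has_vector_derivative cnj (- D (- t))) (at t)"
      by (intro has_vector_derivative_cnj) (simp_all add: o_def)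
    then show ?thesis
      by (simp add: circle_cis_cnj)
  qed
  moreover have "continuous_on UNIV (\<lambda>t. - cnj (D (- t)))"
    by (intro continuous_intros continuous_on_compose2[OF cont]) auto
  ultimately show "(\<lambda>\<theta>. cnj (f (circle_cnj (circle_cis \<theta>)))) C1_differentiable_on UNIV"
    unfolding C1_differentiable_on_def by (intro exI[of _ "\<lambda>t. - cnj (D (- t))"]) simp
qed

lemma ex_c1_identity: "\<exists>A. \<forall>z. c1_apply A z = of_circle z"
proof -
  have "of_circle \<in> {f. (\<lambda>\<theta>. f (circle_cis \<theta>)) C1_differentiable_on UNIV}"
    unfolding C1_differentiable_on_def mem_Collect_eq
    by (intro exI[of _ "\<lambda>\<theta>. \<i> * cis \<theta>"])
       (auto simp: cis_conv_exp intro!: continuous_intros derivative_eq_intros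
          has_vector_derivative_real_field)
  then show ?thesis
    by (metis Abs_c1_circle_inverse)
qed


subsection \<open>The Banach algebra norm\<close>

definition c1_deriv :: "c1_circle \<Rightarrow> circle \<Rightarrow> complex" where
  "c1_deriv f z = vector_derivative (\<lambda>\<theta>. c1_apply f (circle_cis \<theta>)) (at (Arg (of_circle z)))"

(* c1_deriv evaluates the derivative at the principal argument only; by periodicity any argument
   may be used. *)
lemma has_vector_derivative_c1_deriv:
  "((\<lambda>\<theta>. c1_apply f (circle_cis \<theta>)) has_vector_derivative c1_deriv f (circle_cis t)) (at t)"
proof -
  define F where "F = (\<lambda>\<theta>. c1_apply f (circle_cis \<theta>))"
  define s where "s = Arg (cis t)"
  have "F C1_differentiable_on UNIV"
    using c1_apply[of f] by (simp add: F_def)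
  then have "(F has_vector_derivative vector_derivative F (at s)) (at (t + (s - t)))"
    by (simp add: C1_differentiable_on_eq vector_derivative_works)
  then have F': "((F \<circ> (\<lambda>x. x + (s - t))) has_vector_derivative 1 *\<^sub>R vector_derivative F (at s)) (at t)"
    by (intro vector_diff_chain_at) (auto intro!: derivative_eq_intros)
  have "cis s = cis t"
    by (simp add: s_def cis_Arg sgn_div_norm)
  moreover have "cis (x + (s - t)) = cis x * (cis s / cis t)" for x
    by (simp only: cis_mult cis_divide)
  ultimately have "cis (x + (s - t)) = cis x" for x
    by simp
  then have "circle_cis (x + (s - t)) = circle_cis x" for x
    by (simp flip: of_circle_inject)
  then have "F \<circ> (\<lambda>x. x + (s - t)) = F"
    by (simp add: F_def fun_eq_iff)
  with F' show ?thesis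
    by (simp add: F_def s_def c1_deriv_def)
qed

lemma continuous_c1_deriv: "continuous_on UNIV (\<lambda>\<theta>. c1_deriv f (circle_cis \<theta>))"
  using c1_apply[of f]
  by (simp add: C1_differentiable_on_eq
      vector_derivative_at[OF has_vector_derivative_c1_deriv])

lemma continuous_c1_apply: "continuous_on UNIV (\<lambda>\<theta>. c1_apply f (circle_cis \<theta>))"
  using has_vector_derivative_c1_deriv has_vector_derivative_continuous
  by (intro continuous_at_imp_continuous_on) blast

lemma c1_deriv_eqI:
  assumes "\<And>t. ((\<lambda>\<theta>. c1_apply f (circle_cis \<theta>)) has_vector_derivative D (circle_cis t)) (at t)"
  shows "c1_deriv f z = D z"
  using vector_derivative_at[OF assms[of "Arg (of_circle z)"]] by (simp add: c1_deriv_def)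

lemma c1_deriv_simps [simp]:
  "c1_deriv 0 z = 0" "c1_deriv 1 z = 0"
  "c1_deriv (f + g) z = c1_deriv f z + c1_deriv g z"
  "c1_deriv (- f) z = - c1_deriv f z"
  "c1_deriv (f - g) z = c1_deriv f z - c1_deriv g z"
  "c1_deriv (f * g) z = c1_apply f z * c1_deriv g z + c1_deriv f z * c1_apply g z"
  "c1_deriv (c1_scaleC c f) z = c * c1_deriv f z"
proof -
  note [derivative_intros] = has_vector_derivative_c1_deriv
  show "c1_deriv 0 z = 0" "c1_deriv 1 z = 0"
    by (rule c1_deriv_eqI; simp)+
  show "c1_deriv (f + g) z = c1_deriv f z + c1_deriv g z"
    by (rule c1_deriv_eqI) (simp, intro derivative_intros)
  show "c1_deriv (- f) z = - c1_deriv f z"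
    by (rule c1_deriv_eqI) (simp, intro derivative_intros)
  show "c1_deriv (f - g) z = c1_deriv f z - c1_deriv g z"
    by (rule c1_deriv_eqI) (simp, intro derivative_intros)
  show "c1_deriv (f * g) z = c1_apply f z * c1_deriv g z + c1_deriv f z * c1_apply g z"
    by (rule c1_deriv_eqI) (simp, intro has_vector_derivative_mult derivative_intros)
  show "c1_deriv (c1_scaleC c f) z = c * c1_deriv f z"
    by (rule c1_deriv_eqI) (simp, intro has_vector_derivative_mult_right derivative_intros)
qed

lemma bdd_above_circle:
  fixes h :: "circle \<Rightarrow> complex"
  assumes "continuous_on UNIV (\<lambda>\<theta>. h (circle_cis \<theta>))"
  shows "bdd_above (range (\<lambda>z. cmod (h z)))"
proof -
  have "compact ((\<lambda>\<theta>. h (circle_cis \<theta>)) ` {- pi..pi})"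
    by (intro compact_continuous_image continuous_on_subset[OF assms]) auto
  then obtain b where b: "\<And>\<theta>. \<theta> \<in> {- pi..pi} \<Longrightarrow> cmod (h (circle_cis \<theta>)) \<le> b"
    using compact_imp_bounded bounded_iff by (metis imageI)
  have "cmod (h z) \<le> b" for z
    using b[of "Arg (of_circle z)"] Arg_le_pi[of "of_circle z"] mpi_less_Arg[of "of_circle z"]
    by simp
  then show ?thesis
    by (auto intro!: bdd_aboveI)
qed

definition circle_supnorm :: "(circle \<Rightarrow> complex) \<Rightarrow> real" where
  "circle_supnorm h = (SUP z. cmod (h z))"

lemma circle_supnorm_least: "(\<And>z. cmod (h z) \<le> b) \<Longrightarrow> circle_supnorm h \<le> b"
  unfolding circle_supnorm_def by (rule cSUP_least) auto

lemma c1_apply_le_supnorm: "cmod (c1_apply f z) \<le> circle_supnorm (c1_apply f)"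
  unfolding circle_supnorm_def
  by (intro cSUP_upper bdd_above_circle continuous_c1_apply) simp

lemma c1_deriv_le_supnorm: "cmod (c1_deriv f z) \<le> circle_supnorm (c1_deriv f)"
  unfolding circle_supnorm_def
  by (intro cSUP_upper bdd_above_circle continuous_c1_deriv) simp

instantiation c1_circle :: real_algebra_1
begin
definition scaleR_c1_circle :: "real \<Rightarrow> c1_circle \<Rightarrow> c1_circle" where
  "scaleR r = c1_scaleC (complex_of_real r)"
instance
  by standard (auto intro!: c1_eqI simp: scaleR_c1_circle_def algebra_simps)
end

instantiation c1_circle :: real_normed_algebra_1
begin
definition norm_c1_circle :: "c1_circle \<Rightarrow> real" where
  "norm f = circle_supnorm (c1_apply f) + circle_supnorm (c1_deriv f)"
definition sgn_c1_circle :: "c1_circle \<Rightarrow> c1_circle" where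
  "sgn (f :: c1_circle) = f /\<^sub>R norm f"
definition dist_c1_circle :: "c1_circle \<Rightarrow> c1_circle \<Rightarrow> real" where
  "dist (f :: c1_circle) g = norm (f - g)"
definition uniformity_c1_circle :: "(c1_circle \<times> c1_circle) filter" where
  "(uniformity :: (c1_circle \<times> c1_circle) filter) = (INF e\<in>{0 <..}. principal {(x, y). dist x y < e})"
definition open_c1_circle :: "c1_circle set \<Rightarrow> bool" where
  "open (U :: c1_circle set) \<longleftrightarrow> (\<forall>x\<in>U. \<forall>\<^sub>F (x', y) in uniformity. x' = x \<longrightarrow> y \<in> U)"
instance
proof
  fix f g :: c1_circle and r :: real
  note le = c1_apply_le_supnorm c1_deriv_le_supnorm
  have nonneg: "0 \<le> circle_supnorm (c1_apply f)" "0 \<le> circle_supnorm (c1_deriv f)" for f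
    using le[of f undefined] norm_ge_zero order_trans by blast+
  show "norm f = 0 \<longleftrightarrow> f = 0"
  proof
    assume "norm f = 0"
    then have "circle_supnorm (c1_apply f) = 0"
      using nonneg[of f] by (simp add: norm_c1_circle_def)
    then show "f = 0"
      using le(1)[of f] by (auto intro!: c1_eqI)
  next
    have "circle_supnorm (c1_apply 0) \<le> 0" "circle_supnorm (c1_deriv 0) \<le> 0"
      by (rule circle_supnorm_least; simp)+
    then show "norm f = 0" if "f = 0"
      using nonneg[of 0] that by (simp add: norm_c1_circle_def)
  qed
  have "circle_supnorm (c1_apply (f + g)) \<le> circle_supnorm (c1_apply f) + circle_supnorm (c1_apply g)"
    "circle_supnorm (c1_deriv (f + g)) \<le> circle_supnorm (c1_deriv f) + circle_supnorm (c1_deriv g)"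
    by (rule circle_supnorm_least; simp; intro norm_triangle_le add_mono le)+
  then show "norm (f + g) \<le> norm f + norm g"
    by (simp add: norm_c1_circle_def)
  have scale_le: "norm (r *\<^sub>R f) \<le> \<bar>r\<bar> * norm f" for r and f :: c1_circle
  proof -
    have "circle_supnorm (c1_apply (r *\<^sub>R f)) \<le> \<bar>r\<bar> * circle_supnorm (c1_apply f)"
      "circle_supnorm (c1_deriv (r *\<^sub>R f)) \<le> \<bar>r\<bar> * circle_supnorm (c1_deriv f)"
      by (rule circle_supnorm_least; simp add: scaleR_c1_circle_def norm_mult;
          intro mult_left_mono le; simp)+
    then show ?thesis
      by (simp add: norm_c1_circle_def algebra_simps)
  qed
  show "norm (r *\<^sub>R f) = \<bar>r\<bar> * norm f"
  proof (cases "r = 0")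
    case True
    then show ?thesis
      using scale_le[of r f] nonneg[of "r *\<^sub>R f"] by (simp add: norm_c1_circle_def)
  next
    case False
    have "inverse r *\<^sub>R r *\<^sub>R f = f"
      using False by (auto intro!: c1_eqI simp: scaleR_c1_circle_def)
    then have "norm f \<le> \<bar>inverse r\<bar> * norm (r *\<^sub>R f)"
      using scale_le[of "inverse r" "r *\<^sub>R f"] by simp
    then have "\<bar>r\<bar> * norm f \<le> norm (r *\<^sub>R f)"
      using False by (simp add: field_simps)
    then show ?thesis
      using scale_le[of r f] by simp
  qed
  have "circle_supnorm (c1_apply (f * g)) \<le> circle_supnorm (c1_apply f) * circle_supnorm (c1_apply g)"
    by (rule circle_supnorm_least) (simp add: norm_mult mult_mono le nonneg)
  moreover have "circle_supnorm (c1_deriv (f * g)) \<le>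
      circle_supnorm (c1_apply f) * circle_supnorm (c1_deriv g) +
      circle_supnorm (c1_deriv f) * circle_supnorm (c1_apply g)"
    by (rule circle_supnorm_least; simp; intro norm_triangle_le add_mono)
       (simp_all add: norm_mult mult_mono le nonneg)
  moreover have "0 \<le> circle_supnorm (c1_deriv f) * circle_supnorm (c1_deriv g)"
    by (simp add: nonneg)
  ultimately show "norm (f * g) \<le> norm f * norm g"
    by (simp add: norm_c1_circle_def algebra_simps)
  show "norm (1 :: c1_circle) = 1"
    by (simp add: norm_c1_circle_def circle_supnorm_def)
qed (rule sgn_c1_circle_def dist_c1_circle_def uniformity_c1_circle_def open_c1_circle_def)+
end

instance c1_circle :: banach
proof
  fix X :: "nat \<Rightarrow> c1_circle"
  assume X: "Cauchy X"
  have nonneg: "0 \<le> circle_supnorm (c1_apply f)" "0 \<le> circle_supnorm (c1_deriv f)" for f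
    using c1_apply_le_supnorm[of f undefined] c1_deriv_le_supnorm[of f undefined]
      norm_ge_zero order_trans by blast+
  have le: "dist (c1_apply f z) (c1_apply g z) \<le> dist f g" "dist (c1_deriv f z) (c1_deriv g z) \<le> dist f g"
    for f g z
    using c1_apply_le_supnorm[of "f - g" z] c1_deriv_le_supnorm[of "f - g" z] nonneg[of "f - g"]
    by (simp_all add: dist_norm norm_c1_circle_def)
  have "uniformly_Cauchy_on UNIV (\<lambda>n z. c1_apply (X n) z)"
    "uniformly_Cauchy_on UNIV (\<lambda>n z. c1_deriv (X n) z)"
    using X unfolding Cauchy_def uniformly_Cauchy_on_def by (meson le le_less_trans)+
  then obtain g h where g: "uniform_limit UNIV (\<lambda>n. c1_apply (X n)) g sequentially"
      and h: "uniform_limit UNIV (\<lambda>n. c1_deriv (X n)) h sequentially"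
    using Cauchy_uniformly_convergent uniformly_convergent_on_def by blast
  have h_cont: "continuous_on UNIV (\<lambda>\<theta>. h (circle_cis \<theta>))"
    by (rule uniform_limit_theorem[OF always_eventually[OF allI[OF continuous_c1_deriv]]
          uniform_limit_compose'[OF h]]) auto
  have g_tendsto: "(\<lambda>n. c1_apply (X n) z) \<longlonglongrightarrow> g z" for z
    using tendsto_uniform_limitI[OF g, of z] by simp
  have "\<exists>G. \<forall>t\<in>UNIV. (\<lambda>n. c1_apply (X n) (circle_cis t)) \<longlonglongrightarrow> G t \<and>
      (G has_derivative (\<lambda>s. s *\<^sub>R h (circle_cis t))) (at t)"
  proof (rule has_derivative_sequence[where f' = "\<lambda>n t s. s *\<^sub>R c1_deriv (X n) (circle_cis t)"])
    show "((\<lambda>t. c1_apply (X n) (circle_cis t)) has_derivative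
        (\<lambda>s. s *\<^sub>R c1_deriv (X n) (circle_cis t))) (at t within UNIV)" for n t
      using has_vector_derivative_c1_deriv by (simp add: has_vector_derivative_def)
    show "\<forall>\<^sub>F n in sequentially. \<forall>t\<in>UNIV. \<forall>s.
        norm (s *\<^sub>R c1_deriv (X n) (circle_cis t) - s *\<^sub>R h (circle_cis t)) \<le> e * norm s"
      if "0 < e" for e
    proof -
      have "\<forall>\<^sub>F n in sequentially. \<forall>z\<in>UNIV. dist (c1_deriv (X n) z) (h z) < e"
        using h that by (rule uniform_limitD)
      then show ?thesis
      proof eventually_elim
        case (elim n)
        show ?case
        proof (intro ballI allI)
          fix t s :: real
          have "norm (c1_deriv (X n) (circle_cis t) - h (circle_cis t)) \<le> e"
            using elim by (simp add: dist_norm less_imp_le)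
          then have "\<bar>s\<bar> * norm (c1_deriv (X n) (circle_cis t) - h (circle_cis t)) \<le> \<bar>s\<bar> * e"
            by (intro mult_left_mono) auto
          then show "norm (s *\<^sub>R c1_deriv (X n) (circle_cis t) - s *\<^sub>R h (circle_cis t)) \<le> e * norm s"
            by (simp add: mult.commute flip: scaleR_diff_right)
        qed
      qed
    qed
    show "(\<lambda>n. c1_apply (X n) (circle_cis 0)) \<longlonglongrightarrow> g (circle_cis 0)"
      by (rule g_tendsto)
  qed auto
  then obtain G where G: "\<And>t. (\<lambda>n. c1_apply (X n) (circle_cis t)) \<longlonglongrightarrow> G t"
      and G': "\<And>t. (G has_vector_derivative h (circle_cis t)) (at t)"
    unfolding has_vector_derivative_def by blast
  have "G = (\<lambda>\<theta>. g (circle_cis \<theta>))"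
    using LIMSEQ_unique[OF G g_tendsto] by (simp add: fun_eq_iff)
  with G' have g': "((\<lambda>\<theta>. g (circle_cis \<theta>)) has_vector_derivative h (circle_cis t)) (at t)" for t
    by simp
  then have "(\<lambda>\<theta>. g (circle_cis \<theta>)) C1_differentiable_on UNIV"
    unfolding C1_differentiable_on_def using h_cont
    by (intro exI[of _ "\<lambda>\<theta>. h (circle_cis \<theta>)"]) simp
  then obtain L where L: "c1_apply L = g"
    by (metis Abs_c1_circle_inverse mem_Collect_eq)
  then have L': "c1_deriv L z = h z" for z
    using g' by (intro c1_deriv_eqI) simp
  have "X \<longlonglongrightarrow> L"
  proof (rule tendstoI)
    fix e :: real
    assume "0 < e"
    then have "\<forall>\<^sub>F n in sequentially. \<forall>z\<in>UNIV. dist (c1_apply (X n) z) (g z) < e / 3"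
      "\<forall>\<^sub>F n in sequentially. \<forall>z\<in>UNIV. dist (c1_deriv (X n) z) (h z) < e / 3"
      using uniform_limitD[OF g, of "e / 3"] uniform_limitD[OF h, of "e / 3"] by simp_all
    then show "\<forall>\<^sub>F n in sequentially. dist (X n) L < e"
    proof eventually_elim
      case (elim n)
      have "circle_supnorm (c1_apply (X n - L)) \<le> e / 3" "circle_supnorm (c1_deriv (X n - L)) \<le> e / 3"
        using elim by (intro circle_supnorm_least; simp add: L L' dist_norm less_imp_le)+
      then show ?case
        using \<open>0 < e\<close> by (simp add: dist_norm norm_c1_circle_def)
    qed
  qed
  then show "convergent X"
    by (rule convergentI)
qed


section \<open>Maximal ideal space and Gelfand transform\<close>

definition c1_maximal_ideal_space :: "(c1_circle \<Rightarrow> complex) set" where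
  "c1_maximal_ideal_space =
    {\<phi>. Vector_Spaces.linear c1_scaleC (*) \<phi> \<and> (\<forall>f g. \<phi> (f * g) = \<phi> f * \<phi> g) \<and> \<phi> \<noteq> (\<lambda>_. 0)}"

definition gelfand :: "c1_circle \<Rightarrow> (c1_circle \<Rightarrow> complex) \<Rightarrow> complex" where
  "gelfand f \<phi> = \<phi> f"

lemma evaluation_in_maximal_ideal_space: "(\<lambda>f. c1_apply f z) \<in> c1_maximal_ideal_space"
proof -
  have "vector_space ((*) :: complex \<Rightarrow> complex \<Rightarrow> complex)"
    by unfold_locales (simp_all add: algebra_simps)
  then have "Vector_Spaces.linear c1_scaleC (*) (\<lambda>f. c1_apply f z)"
    by (intro Vector_Spaces.linear.intro c1_circle.vector_space_axioms Modules.module_hom.intro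
        Modules.module_hom_axioms.intro c1_circle.module_axioms)
       (simp_all add: module_iff_vector_space)
  moreover have "(\<lambda>f. c1_apply f z) \<noteq> (\<lambda>_. 0)"
    by (metis c1_apply_simps(2) zero_neq_one)
  ultimately show ?thesis
    by (simp add: c1_maximal_ideal_space_def)
qed

lemma c1_semisimple: "(\<And>\<phi>. \<phi> \<in> c1_maximal_ideal_space \<Longrightarrow> gelfand f \<phi> = 0) \<Longrightarrow> f = 0"
  using evaluation_in_maximal_ideal_space by (fastforce intro: c1_eqI simp: gelfand_def)


section \<open>Controllability\<close>

(* The block row [B, A B, ..., A^(n-1) B] for A of size n x n and B of size n x m. *)
definition controllability_matrix :: "complex mat \<Rightarrow> complex mat \<Rightarrow> complex mat" where
  "controllability_matrix A B =
    (let n = dim_row A; m = dim_col B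
     in mat n (n * m) (\<lambda>(i, j). (A ^\<^sub>m (j div m) * B) $$ (i, j mod m)))"

definition controllable :: "complex mat \<Rightarrow> complex mat \<Rightarrow> bool" where
  "controllable A B \<longleftrightarrow>
    square_mat A \<and> dim_row B = dim_row A \<and>
    vec_space.rank (dim_row A) (controllability_matrix A B) = dim_row A"

definition scalar_mat :: "'a \<Rightarrow> 'a mat" where
  "scalar_mat a = mat 1 1 (\<lambda>_. a)"

end

(* A solution P makes Q = P - A a C^1 square root of z^2 + 1. At z = i this gives Q(i) = 0, so
   (Q^2)'(i) = 2 Q(i) Q'(i) = 0, whereas z^2 + 1 has derivative 2 i z^2 = -2i there. *)
theory Submission
  imports Defs
begin

text \<open>Characters send 1 to 1, so both pairs have the form (a, 1), controllable for every a
  (\<open>controllable_scalar_one\<close>). Since \<open>c1_star A = A\<close>, completing the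
  square turns the Riccati equation into (P - A)^2 = A^2 + 1, which
  \<open>no_sqrt_identity_square_plus_one\<close> excludes: the right side has a simple zero at i,
  while the square of a C^1 function has zero derivative wherever it vanishes.\<close>

lemma maximal_ideal_space_one:
  assumes "\<phi> \<in> c1_maximal_ideal_space"
  shows "\<phi> 1 = 1"
proof -
  obtain f where "\<phi> f \<noteq> 0"
    using assms by (auto simp: c1_maximal_ideal_space_def fun_eq_iff)
  moreover have "\<phi> (1 * f) = \<phi> 1 * \<phi> f"
    using assms unfolding c1_maximal_ideal_space_def by blast
  ultimately show ?thesis
    by simp
qed

text \<open>For n = m = 1 the only block is the zeroth power of the state matrix times 1, so a drops
  out.\<close>

lemma controllable_scalar_one: "controllable (scalar_mat a) (scalar_mat 1)"
proof -
  have "controllability_matrix (scalar_mat a) (scalar_mat 1) = 1\<^sub>m 1"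
    by (intro eq_matI)
      (auto simp: controllability_matrix_def scalar_mat_def scalar_prod_def)
  moreover have "vec_space.rank 1 (1\<^sub>m 1 :: complex mat) = 1"
    using vec_space.det_rank_iff[of "1\<^sub>m 1 :: complex mat" 1] by simp
  ultimately show ?thesis
    by (simp add: controllable_def scalar_mat_def)
qed

text \<open>The derivative is taken in the angle, hence the factor i.\<close>

lemma c1_deriv_identity:
  assumes "\<forall>z. c1_apply A z = of_circle z"
  shows "c1_deriv A z = \<i> * of_circle z"
  by (rule c1_deriv_eqI)
    (auto simp: assms cis_conv_exp intro!: derivative_eq_intros has_vector_derivative_real_field)

lemma no_sqrt_identity_square_plus_one:
  assumes A: "\<forall>z. c1_apply A z = of_circle z"
  shows "Q * Q \<noteq> A * A + 1"
proof
  assume eq: "Q * Q = A * A + 1"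
  \<comment> \<open>The point i, a zero of z^2 + 1.\<close>
  define w where "w = circle_cis (pi / 2)"
  have w: "of_circle w = \<i>"
    by (simp add: w_def)
  have "c1_apply (Q * Q) w = c1_apply (A * A + 1) w"
    by (simp only: eq)
  then have "c1_apply Q w = 0"
    by (simp add: A w)
  moreover have "c1_deriv (Q * Q) w = c1_deriv (A * A + 1) w"
    by (simp only: eq)
  ultimately show False
    \<comment> \<open>The product rule gives 0 on the left and 2 i w^2 = -2i on the right.\<close>
    by (simp add: A w c1_deriv_identity[OF A])
qed

theorem mainTheorem2:
  fixes A B C :: c1_circle
  assumes "\<forall>z. c1_apply A z = of_circle z"
    and "\<forall>z. c1_apply B z = 1"
    and "\<forall>z. c1_apply C z = 1"
  shows "(\<forall>\<phi>\<in>c1_maximal_ideal_space.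
            controllable (scalar_mat (gelfand A \<phi>)) (scalar_mat (gelfand B \<phi>)) \<and>
            controllable (scalar_mat (gelfand (c1_star A) \<phi>)) (scalar_mat (gelfand (c1_star C) \<phi>)))
       \<and> \<not> (\<exists>P :: c1_circle.
            P * B * c1_star B * P - P * A - c1_star A * P - c1_star C * C = 0)"
proof -
  have B: "B = 1" and C: "C = 1"
    using assms by (auto intro: c1_eqI)
  \<comment> \<open>For A the two conjugations in the involution cancel.\<close>
  have star: "c1_star 1 = 1" "c1_star A = A"
    by (auto intro!: c1_eqI simp: c1_star.rep_eq assms)
  have "P * P - P * A - A * P - 1 \<noteq> 0" for P
  proof
    assume "P * P - P * A - A * P - 1 = 0"
    \<comment> \<open>Commutativity merges P A and A P into 2 A P.\<close>
    then have "(P - A) * (P - A) = A * A + 1"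
      by (simp add: algebra_simps)
    then show False
      using no_sqrt_identity_square_plus_one[OF assms(1)] by blast
  qed
  then show ?thesis
    by (simp add: B C star gelfand_def maximal_ideal_space_one controllable_scalar_one)
qed

end
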